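(* Let $n>3$ be a positive odd integer. Then \[ \sum_{k=0}^{(n+1)/2}[4k+1]\frac{(q^{-1};q^2)_k^3\, (q;q^2)_k} {(q^4;q^2)_k^3\, (q^2;q^2)_k}\, q^{6k} \equiv 0 \pmod{\Phi_n(q)^3}. \] Moreover, if $\gcd(n,3)=1$, then this congruence holds modulo $[n]\Phi_n(q)^2$.
   Context: Here $q$ is an indeterminate. For $x$ and a base $p$ (a power of $q$), $(x;p)_k=\prod_{j=0}^{k-1}(1-xp^j)$ for integers $k\ge0$. The $q$-integer is $[j]=1+q+\cdots+q^{j-1}$, and $\Phi_n(q)$ is the $n$-th cyclotomic polynomial. For rational functions $A(q),B(q)$ and a polynomial $P(q)$, $A\equiv B\pmod{P}$ means that the numerator of the reduced form of $A-B$ is divisible by $P$ in $\mathbb{Z}[q]$. *)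

theory Defs
  imports Complex_Main "HOL-Computational_Algebra.Computational_Algebra"
begin

text \<open>The fraction field of \<open>\<int>[q]\<close>, i.e. the field of rational functions in \<open>q\<close>.\<close>

type_synonym ratfun = "int poly fract"

definition indet :: ratfun where
  "indet = to_fract [:0, 1:]"

definition qint :: "'a::comm_ring_1 \<Rightarrow> nat \<Rightarrow> 'a" where
  "qint q m = (\<Sum>i<m. q ^ i)"

definition qpoch :: "'a::comm_ring_1 \<Rightarrow> 'a \<Rightarrow> nat \<Rightarrow> 'a" where
  "qpoch x p k = (\<Prod>j<k. 1 - x * p ^ j)"

text \<open>
  \<^const>\<open>quot_of_fract\<close> yields numerator and denominator of the reduced form over \<open>\<int>[q]\<close>
  (coprime in \<open>\<int>[q]\<close>, so common integer factors are cancelled as well), and \<open>dvd\<close> below is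
  divisibility in \<open>\<int>[q]\<close>.
\<close>

definition ratfun_cong :: "ratfun \<Rightarrow> ratfun \<Rightarrow> int poly \<Rightarrow> bool" where
  "ratfun_cong A B P \<longleftrightarrow> P dvd fst (quot_of_fract (A - B))"

definition primitive_roots :: "nat \<Rightarrow> complex set" where
  "primitive_roots n = {z. z ^ n = 1 \<and> (\<forall>m. 0 < m \<and> m < n \<longrightarrow> z ^ m \<noteq> 1)}"

text \<open>
  The integer polynomial whose image in \<open>\<complex>[q]\<close> is the product of \<open>q - z\<close> over the primitive
  \<open>n\<close>-th roots of unity \<open>z\<close>; that it exists and is unique for \<open>n > 0\<close> is
  \<open>map_poly_cyclotomic\<close> below.
\<close>

definition cyclotomic :: "nat \<Rightarrow> int poly" where
  "cyclotomic n = (THE p. map_poly of_int p = (\<Prod>z\<in>primitive_roots n. [:- z, 1:]))"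

lemma map_poly_of_int_mult:
  "map_poly (of_int :: int \<Rightarrow> complex) (p * q) = map_poly of_int p * map_poly of_int q"
  by (rule poly_eqI) (simp add: coeff_map_poly coeff_mult)

lemma map_poly_of_int_add:
  "map_poly (of_int :: int \<Rightarrow> complex) (p + q) = map_poly of_int p + map_poly of_int q"
  by (rule poly_eqI) (simp add: coeff_map_poly)

lemma map_poly_of_int_diff:
  "map_poly (of_int :: int \<Rightarrow> complex) (p - q) = map_poly of_int p - map_poly of_int q"
  by (rule poly_eqI) (simp add: coeff_map_poly)

lemma map_poly_of_int_inj:
  "map_poly (of_int :: int \<Rightarrow> complex) p = map_poly of_int q \<Longrightarrow> p = q"
  by (rule poly_eqI) (metis coeff_map_poly of_int_0 of_int_eq_iff)

lemma monic_int_poly_div: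
  fixes f g :: "int poly" and C :: "complex poly"
  assumes g: "lead_coeff g = 1"
    and eq: "map_poly of_int f = map_poly of_int g * C"
  shows "\<exists>h. map_poly of_int h = C"
proof -
  have g0: "g \<noteq> 0" using g by auto
  obtain h r where hr: "pseudo_divmod f g = (h, r)" by fastforce
  from pseudo_divmod[OF g0 hr] g
  have f: "f = g * h + r" and r: "r = 0 \<or> degree r < degree g" by auto
  let ?M = "map_poly (of_int :: int \<Rightarrow> complex)"
  have deg: "degree (?M p) = degree p" for p
    by (rule degree_map_poly) simp
  have nz: "?M p = 0 \<longleftrightarrow> p = 0" for p
    by (rule map_poly_eq_0_iff) simp_all
  have rr: "?M r = ?M g * (C - ?M h)"
    using eq by (simp add: f map_poly_of_int_add map_poly_of_int_mult algebra_simps)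
  have "C - ?M h = 0"
  proof (rule ccontr)
    assume nz': "C - ?M h \<noteq> 0"
    hence "degree (?M r) = degree g + degree (C - ?M h)"
      using g0 by (subst rr, subst degree_mult_eq) (auto simp: deg nz)
    moreover have "?M r \<noteq> 0" unfolding rr using nz' g0 by (auto simp: nz)
    ultimately show False using r by (auto simp: deg nz)
  qed
  thus ?thesis by (intro exI[of _ h]) simp
qed

lemma finite_primitive_roots: "n > 0 \<Longrightarrow> finite (primitive_roots n)"
  unfolding primitive_roots_def
  by (rule finite_subset[OF _ finite_roots_unity[of n]]) auto

lemma roots_unity_eq_UN_primitive_roots:
  assumes n: "n > 0"
  shows "{z::complex. z ^ n = 1} = (\<Union>d\<in>{d. d dvd n}. primitive_roots d)"
proof (intro equalityI subsetI)
  fix z :: complex assume "z \<in> {z. z ^ n = 1}"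
  hence z: "z ^ n = 1" by simp
  define d where "d = (LEAST m. 0 < m \<and> z ^ m = 1)"
  have d: "0 < d" "z ^ d = 1"
    using LeastI[of "\<lambda>m. 0 < m \<and> z ^ m = 1" n] n z by (auto simp: d_def)
  have least: "z ^ m \<noteq> 1" if "0 < m" "m < d" for m
    using not_less_Least[of m "\<lambda>m. 0 < m \<and> z ^ m = 1"] that by (auto simp: d_def)
  have "z ^ n = (z ^ d) ^ (n div d) * z ^ (n mod d)"
    by (simp flip: power_mult power_add)
  hence "z ^ (n mod d) = 1" using z d by simp
  hence "n mod d = 0" using least[of "n mod d"] d by auto
  thus "z \<in> (\<Union>d\<in>{d. d dvd n}. primitive_roots d)"
    using d least by (auto simp: primitive_roots_def)
next
  fix z :: complex assume "z \<in> (\<Union>d\<in>{d. d dvd n}. primitive_roots d)"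
  thus "z \<in> {z. z ^ n = 1}"
    by (auto simp: primitive_roots_def power_mult elim!: dvdE)
qed

lemma primitive_roots_disjoint:
  assumes "a > 0" "b > 0" "a \<noteq> b"
  shows "primitive_roots a \<inter> primitive_roots b = {}"
  using assms by (auto simp: primitive_roots_def) (metis nat_neq_iff)

lemma prod_roots_unity:
  assumes n: "n > 0"
  shows "(\<Prod>z | z ^ n = (1::complex). [:- z, 1:]) = monom 1 n - 1"
proof -
  define p :: "complex poly" where "p = monom 1 n - 1"
  have "degree p = degree (monom 1 n :: complex poly)"
    unfolding p_def diff_conv_add_uminus using n
    by (intro degree_add_eq_left) (simp add: degree_monom_eq)
  hence deg: "degree p = n" by (simp add: degree_monom_eq)
  have lc: "lead_coeff p = 1" using n by (simp add: deg) (simp add: p_def)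
  have "rsquarefree p"
    unfolding rsquarefree_roots using n
    by (auto simp: p_def pderiv_diff pderiv_monom poly_monom power_0_left)
  from complex_poly_decompose_rsquarefree[OF this] lc
  have "(\<Prod>z | poly p z = 0. [:- z, 1:]) = p" by simp
  thus ?thesis by (simp add: p_def poly_monom)
qed

lemma cyclotomic_exists:
  "n > 0 \<Longrightarrow> \<exists>p. map_poly of_int p = (\<Prod>z\<in>primitive_roots n. [:- z, 1:])"
proof (induction n rule: less_induct)
  case (less n)
  define C where "C = (\<lambda>d. \<Prod>z\<in>primitive_roots d. [:- z, 1:])"
  define D where "D = {d. d dvd n \<and> d \<noteq> n}"
  have finD: "finite D" unfolding D_def using less.prems by simp
  have D: "0 < d \<and> d < n" if "d \<in> D" for d
    using that less.prems dvd_imp_le[of d n] dvd_pos_nat[of n d] by (auto simp: D_def)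
  have "\<exists>p. map_poly of_int p = C d" if "d \<in> D" for d
    using less.IH[of d] D[OF that] by (auto simp: C_def)
  then obtain P where P: "\<And>d. d \<in> D \<Longrightarrow> map_poly of_int (P d) = C d"
    by metis
  define g where "g = prod P D"
  have g: "map_poly of_int g = prod C D"
  proof -
    have "map_poly of_int (prod P E) = prod C E" if "finite E" "E \<subseteq> D" for E
      using that by (induction E rule: finite_induct) (auto simp: map_poly_of_int_mult P)
    thus ?thesis unfolding g_def using finD by blast
  qed
  have "lead_coeff (prod C D) = 1"
    by (simp add: C_def lead_coeff_prod)
  hence "of_int (lead_coeff g) = (1::complex)"
    unfolding g[symmetric] by (simp add: degree_map_poly coeff_map_poly)
  hence lcg: "lead_coeff g = 1" by simp
  have dvds: "{d. d dvd n} = insert n D" by (auto simp: D_def)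
  have "monom 1 n - 1 = (\<Prod>z\<in>(\<Union>d\<in>insert n D. primitive_roots d). [:- z, 1:])"
    using less.prems by (simp flip: prod_roots_unity roots_unity_eq_UN_primitive_roots dvds)
  also have "\<dots> = prod C (insert n D)"
    unfolding C_def
  proof (rule prod.UNION_disjoint)
    show "finite (insert n D)" using finD by simp
    show "\<forall>i\<in>insert n D. finite (primitive_roots i)"
      using D less.prems finite_primitive_roots by blast
    show "\<forall>i\<in>insert n D. \<forall>j\<in>insert n D. i \<noteq> j \<longrightarrow> primitive_roots i \<inter> primitive_roots j = {}"
      using D less.prems primitive_roots_disjoint by blast
  qed
  also have "\<dots> = prod C D * C n"
    using finD by (simp add: D_def mult.commute)
  finally have "map_poly of_int (monom 1 n - 1 :: int poly) = map_poly of_int g * C n"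
    unfolding g by (simp add: map_poly_of_int_diff map_poly_monom)
  from monic_int_poly_div[OF lcg this] show ?case by (simp add: C_def)
qed

lemma map_poly_cyclotomic:
  assumes "n > 0"
  shows "map_poly of_int (cyclotomic n) = (\<Prod>z\<in>primitive_roots n. [:- z, 1:])"
    and "map_poly of_int p = (\<Prod>z\<in>primitive_roots n. [:- z, 1:]) \<Longrightarrow> p = cyclotomic n"
proof -
  have ex1: "\<exists>!p. map_poly of_int p = (\<Prod>z\<in>primitive_roots n. [:- z, 1:])"
    using cyclotomic_exists[OF assms] by (metis map_poly_of_int_inj)
  show "map_poly of_int (cyclotomic n) = (\<Prod>z\<in>primitive_roots n. [:- z, 1:])"
    unfolding cyclotomic_def by (rule theI'[OF ex1])
  thus "p = cyclotomic n" if "map_poly of_int p = (\<Prod>z\<in>primitive_roots n. [:- z, 1:])"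
    using ex1 that by blast
qed

end

theory Submission
  imports Defs
begin

text \<open>
  The sum can be telescoped in closed form (Gosper). With \<open>N = (n + 1) / 2\<close> and \<open>p = q\<^sup>2\<close>, it equals,
  up to powers of \<open>1 - q\<close> and \<open>1 - q\<^sup>3\<close>,
  \<open>W (q ^ (2 * N + 2)) * (1/q; p)\<^sub>N\<^sub>+\<^sub>1\<^sup>3 * (q; p)\<^sub>N\<^sub>+\<^sub>1 / ((q\<^sup>4; p)\<^sub>N\<^sup>3 * (p; p)\<^sub>N)\<close>
  for an explicit polynomial \<open>W\<close>. Let \<open>z ^ n = 1\<close> and \<open>z\<^sup>3 \<noteq> 1\<close>. The numerator consists of the
  factors \<open>1 - q ^ e\<close> with odd \<open>e\<close>, the denominator of those with even \<open>e\<close>, and the reflection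
  \<open>e \<mapsto> n - e\<close> shows that each Pochhammer symbol of the numerator vanishes at \<open>z\<close> to higher order
  than its counterpart in the denominator. So the sum vanishes to order at least \<open>4\<close> at \<open>z\<close>.
\<close>

section \<open>Gosper summation in closed form\<close>

text \<open>\<open>x\<^sup>-\<^sup>3 * telescoper q x\<close>, divided by \<open>(q - 1)\<^sup>4 * (q\<^sup>3 - 1)\<^sup>3\<close>, is the Laurent polynomial solution of
  Gosper's equation for the sum, with \<open>x = q ^ (2 * k)\<close>.\<close>

definition telescoper :: "'a::comm_ring_1 \<Rightarrow> 'a \<Rightarrow> 'a" where
  "telescoper q x =
     (1 + q)^2 * (1 + q^2) * (q^3 + q * x^4)
     - (3*q^2 + 2*q + 3) * (1 + q) * (1 + q^2) * (q^2 * x + q * x^3)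
     + (1 + q + q^2) * (3*q^2 + 1) * (q^2 + 3) * q * x^2"

text \<open>With \<open>r\<close> the inverse of \<open>q\<close> and
  \<open>x = q ^ (2 * k)\<close>, the Pochhammer quotient of the closed form changes from
  \<open>k - 1\<close> to \<open>k\<close> by the first bracketed product over the second. This is
  Gosper's equation with denominators cleared.\<close>

lemma telescoper_step:
  fixes q x r :: "'a::idom"
  assumes "q * r = 1"
  shows "telescoper q (q^2 * x) * ((1 - r * x)^3 * (1 - q * x)) - telescoper q x * ((1 - q^2 * x)^3 * (1 - x))
    = (q - 1)^4 * (q^3 - 1)^3 * x^3 * (1 - q * x^2)"
proof -
  \<comment> \<open>Writing \<open>x = q * z\<close> eliminates \<open>r\<close> and leaves a
    polynomial identity in \<open>q\<close> and \<open>z\<close>.\<close>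
  define z where "z = r * x"
  have x: "x = q * z" using assms by (simp add: z_def flip: mult.assoc)
  show ?thesis unfolding z_def[symmetric] unfolding x telescoper_def
    by (simp add: algebra_simps power2_eq_square power3_eq_cube power4_eq_xxxx)
qed

lemma qpoch_Suc [simp]: "qpoch x p (Suc k) = qpoch x p k * (1 - x * p ^ k)"
  and qpoch_0 [simp]: "qpoch x p 0 = 1"
  by (simp_all add: qpoch_def)

lemma truncated_sum:
  fixes q :: "'a::field"
  assumes q0: "q \<noteq> 0" and q1: "\<And>m. m > 0 \<Longrightarrow> q ^ m \<noteq> 1"
  shows "(\<Sum>k = 0..N. qint q (4 * k + 1) *
      ((qpoch (inverse q) (q^2) k ^ 3 * qpoch q (q^2) k) /
       (qpoch (q^4) (q^2) k ^ 3 * qpoch (q^2) (q^2) k)) * q ^ (6 * k)) *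
      ((1 - q) * ((q - 1)^4 * (q^3 - 1)^3)) =
    telescoper q (q ^ (2 * N + 2)) *
      (qpoch (inverse q) (q^2) (Suc N) ^ 3 * qpoch q (q^2) (Suc N)) /
      (qpoch (q^4) (q^2) N ^ 3 * qpoch (q^2) (q^2) N)"
proof (induction N)
  case 0
  \<comment> \<open>At \<open>x = 1\<close> the factor \<open>1 - x\<close> kills the subtracted
    term, so telescoping starts without a boundary term.\<close>
  show ?case using telescoper_step[of q "inverse q" 1] q0
    by (auto simp: qint_def mult_ac power2_eq_square)
next
  case (Suc N)
  define x where "x = q ^ (2 * N + 2)"
  let ?K = "(q - 1)^4 * (q^3 - 1)^3"
  define P where "P = qpoch (inverse q) (q^2) (Suc N)"
  define Q where "Q = qpoch q (q^2) (Suc N)"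
  define R where "R = qpoch (q^4) (q^2) N"
  define T where "T = qpoch (q^2) (q^2) N"
  have pw: "(q^2) ^ Suc N = x" "q ^ (6 * Suc N) = x ^ 3" "q ^ (2 * Suc N + 2) = q^2 * x"
     "q ^ (4 * Suc N + 1) = q * x^2"
    unfolding x_def power_mult[symmetric] power_add[symmetric] power_Suc[symmetric]
    by (rule arg_cong[where f = "power q"], simp)+
  have qi: "qint q (4 * Suc N + 1) * (1 - q) = 1 - q * x^2"
    using one_diff_power_eq[of q "4 * Suc N + 1"] pw(4) by (simp add: qint_def mult.commute)
  have "q^4 * (q^2) ^ N = q^2 * x" "q^2 * (q^2) ^ N = x"
    unfolding x_def power_mult[symmetric] power_add[symmetric]
    by (rule arg_cong[where f = "power q"], simp)+
  then have R': "qpoch (q^4) (q^2) (Suc N) = R * (1 - q^2 * x)"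
    and T': "qpoch (q^2) (q^2) (Suc N) = T * (1 - x)"
    by (simp_all add: R_def T_def)
  have P': "qpoch (inverse q) (q^2) (Suc (Suc N)) = P * (1 - inverse q * x)"
    and Q': "qpoch q (q^2) (Suc (Suc N)) = Q * (1 - q * x)"
    unfolding qpoch_Suc[of _ _ "Suc N"] pw P_def Q_def by simp_all
  have nz: "1 - x \<noteq> 0" "1 - q^2 * x \<noteq> 0"
    using q1[of "2 * N + 2"] q1[of "2 * Suc N + 2"]
    unfolding pw(3) x_def[symmetric] by simp_all
  define u where "u = (1 - q^2 * x)^3 * (1 - x)"
  have u: "u \<noteq> 0" using nz by (simp add: u_def)
  have D: "(R * (1 - q^2 * x)) ^ 3 * (T * (1 - x)) = R ^ 3 * T * u"
    by (simp only: u_def power_mult_distrib mult_ac)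
  \<comment> \<open>In the subtracted term of Gosper's equation the new denominator factors
    \<open>u\<close> cancel, which leaves the closed form for \<open>N\<close>.\<close>
  have split_diff: "(A - B * u) * c / (d * u) = A * c / (d * u) - B * c / d" for A B c d
    using u by (simp add: left_diff_distrib diff_divide_distrib)
  have "(qint q (4 * Suc N + 1) *
      ((P ^ 3 * Q) / ((R * (1 - q^2 * x)) ^ 3 * (T * (1 - x)))) * x ^ 3) * ((1 - q) * ?K)
     = (?K * x ^ 3 * (1 - q * x^2)) * (P ^ 3 * Q) / ((R * (1 - q^2 * x)) ^ 3 * (T * (1 - x)))"
    unfolding qi[symmetric] by (simp add: mult_ac)
  also have "?K * x ^ 3 * (1 - q * x^2) =
      telescoper q (q^2 * x) * ((1 - inverse q * x)^3 * (1 - q * x)) - telescoper q x * ((1 - q^2 * x)^3 * (1 - x))"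
    by (rule telescoper_step[symmetric]) (use q0 in simp)
  also have "\<dots> * (P ^ 3 * Q) / ((R * (1 - q^2 * x)) ^ 3 * (T * (1 - x))) =
      telescoper q (q^2 * x) * ((P * (1 - inverse q * x))^3 * (Q * (1 - q * x)))
        / ((R * (1 - q^2 * x)) ^ 3 * (T * (1 - x)))
      - telescoper q x * (P ^ 3 * Q) / (R ^ 3 * T)"
    unfolding D u_def[symmetric] split_diff by (simp only: power_mult_distrib mult_ac)
  finally show ?case
    unfolding sum.atLeast0_atMost_Suc distrib_right Suc.IH
    unfolding pw P' Q' R' T' P_def[symmetric] Q_def[symmetric] R_def[symmetric] T_def[symmetric] x_def[symmetric]
    by simp
qed


text \<open>After the first factor the exponents \<open>-1, 1, 3, ...\<close> are those of
  \<open>qpoch q (q^2)\<close>, so negative powers of \<open>q\<close> are confined to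
  \<open>1 - inverse q\<close>.\<close>

lemma qpoch_inverse_Suc:
  fixes q :: "'a::field"
  assumes "q \<noteq> 0"
  shows "qpoch (inverse q) (q^2) (Suc k) = (1 - inverse q) * qpoch q (q^2) k"
proof (induction k)
  case (Suc k)
  have "inverse q * (q^2) ^ Suc k = q * (q^2) ^ k"
    using assms by (simp add: power2_eq_square)
  then show ?case using Suc by (simp only: qpoch_Suc[of _ _ "Suc k"]) simp
qed simp

section \<open>Transfer between rational functions, integer and complex polynomials\<close>

lemma qpoch_hom:
  assumes "f 1 = 1" "\<And>x y. f (x * y) = f x * f y" "\<And>x y. f (x - y) = f x - f y"
  shows "f (qpoch x p k) = qpoch (f x) (f p) k"
proof -
  have "f (p ^ j) = f p ^ j" for j by (induction j) (simp_all add: assms)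
  then show ?thesis by (induction k) (simp_all add: assms)
qed

lemma to_fract_power [simp]: "to_fract (x ^ k) = to_fract x ^ k"
  by (induction k) simp_all

lemma to_fract_numeral [simp]: "to_fract (numeral k) = numeral k"
proof -
  have "to_fract (of_nat m) = of_nat m" for m by (induction m) simp_all
  from this[of "numeral k"] show ?thesis by simp
qed

lemma to_fract_qpoch [simp]: "to_fract (qpoch x p k) = qpoch (to_fract x) (to_fract p) k"
  by (rule qpoch_hom) simp_all

lemma to_fract_telescoper [simp]: "to_fract (telescoper q x) = telescoper (to_fract q) (to_fract x)"
  by (simp add: telescoper_def)

abbreviation cpoly :: "int poly \<Rightarrow> complex poly" where
  "cpoly \<equiv> map_poly of_int"

lemma cpoly_power [simp]: "cpoly (p ^ k) = cpoly p ^ k"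
  by (induction k) (simp_all add: map_poly_of_int_mult)

lemma cpoly_qpoch: "cpoly (qpoch x p k) = qpoch (cpoly x) (cpoly p) k"
  by (rule qpoch_hom) (simp_all add: map_poly_of_int_mult map_poly_of_int_diff)

lemma cpoly_eq_0_iff [simp]: "cpoly p = 0 \<longleftrightarrow> p = 0"
  by (rule map_poly_eq_0_iff) simp_all

lemma cpoly_X [simp]: "cpoly [:0, 1:] = [:0, 1:]"
  by (simp add: map_poly_pCons)

section \<open>Multiplicities of roots of unity in Pochhammer symbols\<close>

lemma X_power_neq_1: "m > 0 \<Longrightarrow> [:0, 1:] ^ m \<noteq> (1 :: 'a::idom poly)"
  by (metis degree_linear_power degree_1 less_irrefl)

lemma one_diff_X_power_neq_0: "m > 0 \<Longrightarrow> 1 - [:0, 1:] ^ m \<noteq> (0 :: 'a::idom poly)"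
  using X_power_neq_1[of m, where 'a = 'a] by simp

text \<open>The derivative has no root other than 0, which is not a root of
  \<open>1 - X ^ m\<close>; hence all roots are simple.\<close>

lemma order_one_diff_X_power:
  assumes "m > 0"
  shows "order z (1 - [:0, 1:] ^ m :: complex poly) = (if z ^ m = 1 then 1 else 0)"
proof -
  let ?p = "1 - [:0, 1:] ^ m :: complex poly"
  have p: "?p = 1 - monom 1 m" by (simp add: monom_altdef)
  have nz: "?p \<noteq> 0" by (rule one_diff_X_power_neq_0[OF assms])
  have "rsquarefree ?p"
    unfolding rsquarefree_roots p using assms
    by (auto simp: pderiv_diff pderiv_monom poly_monom power_0_left)
  then have "order z ?p = 0 \<or> order z ?p = 1" by (simp add: rsquarefree_def)
  moreover have "order z ?p = 0 \<longleftrightarrow> z ^ m \<noteq> 1"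
    using order_eq_0_iff[OF nz] by (simp add: poly_power)
  ultimately show ?thesis by auto
qed

lemma qpoch_X_factor: "([:0, 1:] ^ i * ([:0, 1:] ^ 2) ^ k :: 'a::idom poly) = [:0, 1:] ^ (i + 2 * k)"
  by (simp flip: power_mult power_add)

lemma qpoch_X_neq_0: "i > 0 \<Longrightarrow> qpoch ([:0, 1:] ^ i) ([:0, 1:] ^ 2) k \<noteq> (0 :: 'a::idom poly)"
  unfolding qpoch_def qpoch_X_factor by (simp add: one_diff_X_power_neq_0 del: right_minus_eq)

lemma order_qpoch_X:
  assumes "i > 0"
  shows "order z (qpoch ([:0, 1:] ^ i) ([:0, 1:] ^ 2) k :: complex poly) = card {j. j < k \<and> z ^ (i + 2 * j) = 1}"
proof (induction k)
  case (Suc k)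
  have "{j. j < Suc k \<and> z ^ (i + 2 * j) = 1} =
      {j. j < k \<and> z ^ (i + 2 * j) = 1} \<union> (if z ^ (i + 2 * k) = 1 then {k} else {})"
    by (auto simp: less_Suc_eq)
  then have "card {j. j < Suc k \<and> z ^ (i + 2 * j) = 1} =
      card {j. j < k \<and> z ^ (i + 2 * j) = 1} + (if z ^ (i + 2 * k) = 1 then 1 else 0)"
    by simp
  moreover have "qpoch ([:0, 1:] ^ i) ([:0, 1:] ^ 2) (Suc k) \<noteq> (0 :: complex poly)"
    by (rule qpoch_X_neq_0[OF assms])
  ultimately show ?case
    using Suc assms unfolding qpoch_Suc qpoch_X_factor
    by (subst order_mult) (simp_all add: order_one_diff_X_power)
qed simp

text \<open>The reflection \<open>e \<mapsto> n - e\<close> sends the even exponents \<open>e\<close> with \<open>z ^ e = 1\<close> to odd ones,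
  and misses the exponent \<open>n\<close>.\<close>

lemma card_even_exponents_less:
  fixes z :: complex
  assumes "z ^ n = 1" "n = 2 * N - 1" "0 < N" "N \<le> M" "i + m = N"
    and "0 < i" "\<And>j. m \<le> j \<Longrightarrow> j < N \<Longrightarrow> z ^ (2 * i + 2 * j) \<noteq> 1"
  shows "card {j. j < N \<and> z ^ (2 * i + 2 * j) = 1} < card {j. j < M \<and> z ^ (1 + 2 * j) = 1}"
proof -
  let ?A = "{j. j < N \<and> z ^ (2 * i + 2 * j) = 1}" and ?B = "{j. j < M \<and> z ^ (1 + 2 * j) = 1}"
  \<comment> \<open>This makes the truncated subtraction \<open>m - Suc j\<close> exact. As
    \<open>i > 0\<close>, its value stays below \<open>N - 1\<close>, the index of the exponent
    \<open>n\<close>.\<close>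
  have A: "j < m" if "j \<in> ?A" for j using assms(7)[of j] that by force
  have "(\<lambda>j. m - Suc j) ` ?A \<subseteq> ?B - {N - 1}"
  proof (intro image_subsetI)
    fix j assume j: "j \<in> ?A"
    have "1 + 2 * (m - Suc j) + (2 * i + 2 * j) = n"
      using A[OF j] assms by simp
    then have "z ^ (1 + 2 * (m - Suc j)) * z ^ (2 * i + 2 * j) = 1"
      using assms(1) by (simp only: flip: power_add)
    then have "z ^ (1 + 2 * (m - Suc j)) = 1" using j by simp
    then show "m - Suc j \<in> ?B - {N - 1}" using A[OF j] assms by auto
  qed
  moreover have "inj_on (\<lambda>j. m - Suc j) ?A"
  proof (rule inj_onI)
    fix j k assume "j \<in> ?A" "k \<in> ?A" "m - Suc j = m - Suc k"
    then show "j = k" using A[of j] A[of k] by linarith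
  qed
  ultimately have "card ?A \<le> card (?B - {N - 1})"
    by (intro card_inj_on_le) auto
  also have "\<dots> < card ?B"
  proof (rule card_Diff1_less)
    have "1 + 2 * (N - 1) = n" "N - 1 < M" using assms(2-4) by simp_all
    then show "N - 1 \<in> ?B" using assms(1) by (simp only: mem_Collect_eq simp_thms)
  qed simp
  finally show ?thesis .
qed


section \<open>Vanishing order of the sum at a root of unity\<close>

text \<open>Three of the four orders come from the cubed quotient, one from the other. The
  hypothesis \<open>z ^ 3 \<noteq> 1\<close> keeps Gosper's normalising factor from vanishing at
  \<open>z\<close>.\<close>

lemma order_numerator:
  fixes n :: nat and z :: complex
  defines "q \<equiv> indet"
  defines "S \<equiv> (\<Sum>k = 0..(n + 1) div 2.
      qint q (4 * k + 1) *
      (((qpoch (inverse q) (q ^ 2) k) ^ 3 * qpoch q (q ^ 2) k) /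
       ((qpoch (q ^ 4) (q ^ 2) k) ^ 3 * qpoch (q ^ 2) (q ^ 2) k)) *
      q ^ (6 * k))"
  assumes "odd n" "z ^ n = 1" "z ^ 3 \<noteq> 1"
  shows "[:- z, 1:] ^ 4 dvd cpoly (fst (quot_of_fract S))"
proof -
  define N where "N = (n + 1) div 2"
  have n: "n = 2 * N - 1" "0 < N" using \<open>odd n\<close> by (auto simp: N_def elim!: oddE)
  define U where "U = fst (quot_of_fract S)"
  define V where "V = snd (quot_of_fract S)"
  let ?X = "[:0, 1:] :: int poly"
  let ?Y = "[:0, 1:] :: complex poly"
  have z1: "z \<noteq> 1" using assms(5) by auto
  have z0: "z \<noteq> 0" using assms(4) n by (auto simp: power_0_left)
  have q: "q = to_fract ?X" by (simp add: q_def indet_def)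
  have q0: "q \<noteq> 0" by (simp add: q)
  have q1: "q ^ m \<noteq> 1" if "m > 0" for m
    using X_power_neq_1[OF that, where 'a = int]
    unfolding q to_fract_power[symmetric] to_fract_1[symmetric] to_fract_eq_iff .
  define R where "R = qpoch (?X^4) (?X^2) N"
  define T where "T = qpoch (?X^2) (?X^2) N"
  define Q where "Q = (\<lambda>k. qpoch (?X^1) (?X^2) k)"
  \<comment> \<open>The factor \<open>?X^3\<close> clears the cube of \<open>1 - inverse q\<close>,
    which becomes \<open>(?X - 1)^3\<close> in \<open>E\<close>.\<close>
  define D where "D = (1 - ?X) * ((?X - 1)^4 * (?X^3 - 1)^3) * ?X^3"
  define E where "E = telescoper ?X (?X ^ (2 * N + 2)) * (?X - 1)^3"
  have RT0: "R \<noteq> 0" "T \<noteq> 0"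
    unfolding R_def T_def by (intro qpoch_X_neq_0, simp)+
  have P: "qpoch (inverse q) (q^2) (Suc N) ^ 3 * q ^ 3 = (q - 1) ^ 3 * to_fract (Q N) ^ 3"
  proof -
    have "(1 - inverse q) * q = q - 1" using q0 by (simp add: algebra_simps)
    then have "((1 - inverse q) * to_fract (Q N)) ^ 3 * q ^ 3 = ((q - 1) * to_fract (Q N)) ^ 3"
      unfolding power_mult_distrib[symmetric] by (metis mult.commute mult.assoc)
    then show ?thesis
      unfolding qpoch_inverse_Suc[OF q0] power_mult_distrib Q_def by (simp add: q)
  qed
  have "S * ((1 - q) * ((q - 1)^4 * (q^3 - 1)^3)) =
      telescoper q (q ^ (2 * N + 2)) * (qpoch (inverse q) (q^2) (Suc N) ^ 3 * to_fract (Q (Suc N))) /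
      to_fract (R ^ 3 * T)"
    using truncated_sum[OF q0 q1, of N]
    unfolding S_def N_def[symmetric] Q_def R_def T_def to_fract_mult to_fract_power to_fract_qpoch
      q[symmetric] power_one_right .
  then have "S * ((1 - q) * ((q - 1)^4 * (q^3 - 1)^3)) * to_fract (R ^ 3 * T) =
      telescoper q (q ^ (2 * N + 2)) * (qpoch (inverse q) (q^2) (Suc N) ^ 3 * to_fract (Q (Suc N)))"
    using RT0 by (simp only: nonzero_eq_divide_eq to_fract_eq_0_iff) simp
  from arg_cong[OF this, of "\<lambda>y. y * q ^ 3"] have "S * (((1 - q) * ((q - 1)^4 * (q^3 - 1)^3)) * q ^ 3) * to_fract (R ^ 3 * T) =
      telescoper q (q ^ (2 * N + 2)) * to_fract (Q (Suc N)) * (qpoch (inverse q) (q^2) (Suc N) ^ 3 * q ^ 3)"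
    by (simp only: mult_ac)
  then have SD: "S * to_fract (D * R ^ 3 * T) = to_fract (E * Q N ^ 3 * Q (Suc N))"
    unfolding P D_def E_def to_fract_mult to_fract_diff to_fract_power to_fract_1 to_fract_telescoper
      q[symmetric] by (simp only: mult_ac)
  have SV: "S * to_fract V = to_fract U"
    using Fract_quot_of_fract[of S] unfolding Fract_conv_to_fract
    by (simp add: U_def V_def field_simps)
  \<comment> \<open>Cross-multiplying the reduced form of \<open>S\<close> with its closed form
    gives an identity in the integer polynomials.\<close>
  have clear: "u * d = v * e"
    if "S * to_fract d = to_fract e" "S * to_fract v = to_fract u" for u v d e
  proof -
    have "to_fract u * to_fract d = to_fract v * to_fract e"
      unfolding that[symmetric] by (simp only: mult_ac)
    then show ?thesis unfolding to_fract_mult[symmetric] to_fract_eq_iff .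
  qed
  have "U * (D * R ^ 3 * T) = V * (E * Q N ^ 3 * Q (Suc N))"
    by (rule clear[OF SD SV])
  from arg_cong[OF this, of cpoly]
  have eq: "cpoly U * (cpoly D * cpoly R ^ 3 * cpoly T) =
      (cpoly V * cpoly E) * cpoly (Q N) ^ 3 * cpoly (Q (Suc N))"
    by (simp only: map_poly_of_int_mult cpoly_power mult_ac)
  have oR: "order z (cpoly R) = card {j. j < N \<and> z ^ (4 + 2 * j) = 1}"
    and oT: "order z (cpoly T) = card {j. j < N \<and> z ^ (2 + 2 * j) = 1}"
    and oQ: "order z (cpoly (Q k)) = card {j. j < k \<and> z ^ (1 + 2 * j) = 1}" for k
    unfolding R_def T_def Q_def cpoly_qpoch cpoly_power cpoly_X
    by (rule order_qpoch_X, simp)+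
  have pD: "poly (cpoly D) z \<noteq> 0"
    using z0 z1 assms(5)
    by (simp add: D_def map_poly_of_int_mult map_poly_of_int_diff poly_power)
  have z_shift: "z ^ (2 * N + k) = z ^ Suc k" for k
  proof -
    have "2 * N + k = n + Suc k" using n by simp
    then show ?thesis using assms(4) by (simp only: power_add mult_1)
  qed
  have R_less: "order z (cpoly R) < order z (cpoly (Q N))"
  proof (cases "N = 1")
    case True
    then show ?thesis using assms(4,5) n by simp
  next
    case False
    \<comment> \<open>Of the exponents \<open>4, ..., 2 * N + 2\<close> only the last two exceed
      \<open>n\<close>, out of reach of the reflection. There the power of \<open>z\<close> is
      \<open>z\<close> and \<open>z ^ 3\<close>.\<close>
    have "z ^ (2 * 2 + 2 * j) \<noteq> 1" if "N - 2 \<le> j" "j < N" for j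
    proof -
      have "j = N - 2 \<or> j = N - 1" using that by auto
      then have "2 * 2 + 2 * j = 2 * N + 0 \<or> 2 * 2 + 2 * j = 2 * N + 2" using False n by auto
      then show ?thesis
      proof (elim disjE)
        assume "2 * 2 + 2 * j = 2 * N + 0"
        then show ?thesis using z_shift[of 0] z1 by (simp only:) simp
      next
        assume "2 * 2 + 2 * j = 2 * N + 2"
        then show ?thesis using z_shift[of 2] assms(5) by (simp only: eval_nat_numeral) simp
      qed
    qed
    then have "card {j. j < N \<and> z ^ (2 * 2 + 2 * j) = 1} < card {j. j < N \<and> z ^ (1 + 2 * j) = 1}"
      by (intro card_even_exponents_less[of z n N N 2 "N - 2"]) (use assms(4) n False in simp_all)
    then show ?thesis unfolding oR oQ by simp
  qed
  have T_less: "order z (cpoly T) < order z (cpoly (Q (Suc N)))"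
  proof -
    \<comment> \<open>Here only the exponent \<open>2 * N = n + 1\<close> exceeds
      \<open>n\<close>.\<close>
    have "z ^ (2 * 1 + 2 * j) \<noteq> 1" if "N - 1 \<le> j" "j < N" for j
    proof -
      have "2 * 1 + 2 * j = 2 * N + 0" using that by auto
      then show ?thesis using z_shift[of 0] z1 by simp
    qed
    then have "card {j. j < N \<and> z ^ (2 * 1 + 2 * j) = 1} < card {j. j < Suc N \<and> z ^ (1 + 2 * j) = 1}"
      by (intro card_even_exponents_less[of z n N "Suc N" 1 "N - 1"]) (use assms(4) n in simp_all)
    then show ?thesis unfolding oT oQ by simp
  qed
  show ?thesis
  proof (cases "U = 0")
    case False
    have D0: "cpoly D \<noteq> 0" using pD by auto
    have L0: "cpoly U * (cpoly D * cpoly R ^ 3 * cpoly T) \<noteq> 0"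
      using False D0 RT0 by simp
    have o3: "order z (p ^ 3) = 3 * order z p" if "p \<noteq> 0" for p
      using that by (simp add: power3_eq_cube order_mult)
    have "order z (cpoly U) + 3 * order z (cpoly R) + order z (cpoly T)
        = order z (cpoly U * (cpoly D * cpoly R ^ 3 * cpoly T))"
      using L0 order_0I[OF pD] by (simp add: order_mult o3)
    \<comment> \<open>The orders of \<open>cpoly V\<close> and \<open>cpoly E\<close> are
      dropped.\<close>
    also have "\<dots> \<ge> 3 * order z (cpoly (Q N)) + order z (cpoly (Q (Suc N)))"
      using L0 unfolding eq by (simp add: order_mult o3)
    finally show ?thesis
      using R_less T_less unfolding U_def[symmetric] order_divides by linarith
  qed (simp add: U_def)
qed

section \<open>From root multiplicities to divisibility over the integers\<close>

text \<open>Dividing out the power of one linear factor leaves the order at every other point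
  unchanged.\<close>

lemma prod_linear_power_dvd:
  fixes p :: "'a::idom poly"
  assumes "finite A" "\<And>z. z \<in> A \<Longrightarrow> [:- z, 1:] ^ k dvd p"
  shows "(\<Prod>z\<in>A. [:- z, 1:]) ^ k dvd p"
  using assms
proof (induction A arbitrary: p rule: finite_induct)
  case (insert z A)
  then obtain r where p: "p = [:- z, 1:] ^ k * r" using insert.prems[of z] unfolding dvd_def by auto
  have "[:- y, 1:] ^ k dvd r" if "y \<in> A" for y
  proof (cases "r = 0")
    case False
    have "y \<noteq> z" using that insert.hyps by auto
    then have "order y ([:- z, 1:] ^ k) = 0" by (intro order_0I) (simp add: poly_power)
    then have "order y p = order y r" using False unfolding p by (subst order_mult) auto
    moreover have "p \<noteq> 0" using False by (simp add: p)
    ultimately show ?thesis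
      using insert.prems[of y] that False by (simp add: order_divides)
  qed simp
  then have "(\<Prod>z\<in>A. [:- z, 1:]) ^ k dvd r" by (rule insert.IH)
  then show ?case
    unfolding p prod.insert[OF insert.hyps] power_mult_distrib by (intro mult_dvd_mono dvd_refl)
qed simp

text \<open>As a product of monic factors \<open>g\<close> is monic, so the complex quotient has
  integer coefficients.\<close>

lemma power_dvd_if_linear_powers_dvd:
  assumes "finite A" and g: "cpoly g = (\<Prod>z\<in>A. [:- z, 1:])"
    and "\<And>z. z \<in> A \<Longrightarrow> [:- z, 1:] ^ k dvd cpoly f"
  shows "g ^ k dvd f"
proof -
  have "lead_coeff (cpoly g) = 1" unfolding g by (simp add: lead_coeff_prod)
  then have "complex_of_int (lead_coeff g) = 1" by (simp add: degree_map_poly coeff_map_poly)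
  then have lc: "lead_coeff (g ^ k) = 1" by (simp add: lead_coeff_power)
  have "cpoly g ^ k dvd cpoly f"
    unfolding g by (rule prod_linear_power_dvd) (use assms in auto)
  then obtain C where C: "cpoly f = cpoly (g ^ k) * C" by (auto elim: dvdE)
  obtain h where "cpoly h = C" using monic_int_poly_div[OF lc C] by blast
  then have "f = g ^ k * h" using C map_poly_of_int_inj by (metis map_poly_of_int_mult)
  then show ?thesis by simp
qed

text \<open>Multiplication by \<open>X - 1\<close> gives \<open>X ^ n - 1\<close>; the factor of the
  root 1 then cancels.\<close>

lemma cpoly_qint:
  assumes "n > 0"
  shows "cpoly (qint [:0, 1:] n) = (\<Prod>z\<in>{z. z ^ n = 1} - {1}. [:- z, 1:])"
proof -
  have "cpoly ([:0, 1:] - 1) = [:0, 1:] - 1"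
    by (simp add: map_poly_of_int_diff)
  also have "\<dots> = [:- 1, 1:]" by (simp add: one_pCons)
  finally have "[:- 1, 1:] * cpoly (qint [:0, 1:] n) = cpoly (([:0, 1:] - 1) * qint [:0, 1:] n)"
    unfolding map_poly_of_int_mult by simp
  also have "([:0, 1:] - 1) * qint [:0, 1:] n = ([:0, 1:] ^ n - 1 :: int poly)"
    unfolding qint_def by (rule power_diff_1_eq[symmetric])
  also have "cpoly ([:0, 1:] ^ n - 1) = monom 1 n - 1"
    by (simp add: map_poly_of_int_diff monom_altdef)
  also have "\<dots> = (\<Prod>z | z ^ n = 1. [:- z, 1:])" by (rule prod_roots_unity[OF assms, symmetric])
  also have "\<dots> = [:- 1, 1:] * (\<Prod>z\<in>{z. z ^ n = 1} - {1}. [:- z, 1:])"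
    using assms by (intro prod.remove) (auto simp: finite_roots_unity)
  finally show ?thesis by (subst (asm) mult_cancel_left) auto
qed

lemma cyclotomic_dvd_qint:
  assumes "n > 1"
  shows "cyclotomic n dvd qint [:0, 1:] n"
proof -
  have "cyclotomic n ^ 1 dvd qint [:0, 1:] n"
  proof (rule power_dvd_if_linear_powers_dvd)
    show "finite (primitive_roots n)" "cpoly (cyclotomic n) = (\<Prod>z\<in>primitive_roots n. [:- z, 1:])"
      using assms by (simp_all add: finite_primitive_roots map_poly_cyclotomic)
    fix z assume z: "z \<in> primitive_roots n"
    then have "z \<in> {z. z ^ n = 1} - {1}"
      using assms by (auto simp: primitive_roots_def)
    then show "[:- z, 1:] ^ 1 dvd cpoly (qint [:0, 1:] n)"
      using assms dvd_prodI[of "{z. z ^ n = 1} - {1}" z "\<lambda>z. [:- z, 1:]"]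
      by (simp add: cpoly_qint finite_roots_unity)
  qed
  then show ?thesis by simp
qed

theorem theorem5p7:
  fixes n :: nat and q :: ratfun and S :: ratfun
  defines "q \<equiv> indet"
  defines "S \<equiv> (\<Sum>k = 0..(n + 1) div 2.
      qint q (4 * k + 1) *
      (((qpoch (inverse q) (q ^ 2) k) ^ 3 * qpoch q (q ^ 2) k) /
       ((qpoch (q ^ 4) (q ^ 2) k) ^ 3 * qpoch (q ^ 2) (q ^ 2) k)) *
      q ^ (6 * k))"
  assumes "n > 3" and "odd n"
  shows "ratfun_cong S 0 (cyclotomic n ^ 3) \<and>
    (gcd n 3 = 1 \<longrightarrow> ratfun_cong S 0 (qint [:0, 1:] n * cyclotomic n ^ 2))"
proof (intro conjI impI)
  let ?U = "fst (quot_of_fract S)"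
  have ord: "[:- z, 1:] ^ 3 dvd cpoly ?U" if "z ^ n = 1" "z ^ 3 \<noteq> 1" for z
    using order_numerator[OF \<open>odd n\<close> that] unfolding S_def q_def
    by (rule dvd_trans[rotated]) (simp add: le_imp_power_dvd)
  have "cyclotomic n ^ 3 dvd ?U"
  proof (rule power_dvd_if_linear_powers_dvd)
    show "finite (primitive_roots n)" "cpoly (cyclotomic n) = (\<Prod>z\<in>primitive_roots n. [:- z, 1:])"
      using assms(3) by (simp_all add: finite_primitive_roots map_poly_cyclotomic)
  \<comment> \<open>As \<open>n > 3\<close>, a primitive \<open>n\<close>-th root of unity has
    \<open>z ^ 3 \<noteq> 1\<close>.\<close>
  qed (use assms(3) in \<open>auto simp: primitive_roots_def intro!: ord\<close>)
  then show "ratfun_cong S 0 (cyclotomic n ^ 3)" by (simp add: ratfun_cong_def)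
  assume gcd: "gcd n 3 = 1"
  have z3: "z ^ 3 \<noteq> 1" if "z ^ n = 1" "z \<noteq> 1" for z :: complex
  proof
    assume "z ^ 3 = 1"
    obtain a b where "a * n = b * 3 + (1::nat)"
      using bezout_nat[of n 3] assms(3) gcd by (auto simp: mult.commute)
    then have "(z ^ n) ^ a = (z ^ 3) ^ b * z" by (metis power_mult mult.commute power_add power_one_right)
    then show False using that \<open>z ^ 3 = 1\<close> by simp
  qed
  \<comment> \<open>Every \<open>n\<close>-th root of unity except 1 now qualifies, so even the cube
    of \<open>[n]\<close> divides; the required modulus divides that cube.\<close>
  have "qint [:0, 1:] n ^ 3 dvd ?U"
  proof (rule power_dvd_if_linear_powers_dvd)
    show "finite ({z::complex. z ^ n = 1} - {1})"
      using assms(3) by (simp add: finite_roots_unity)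
    show "cpoly (qint [:0, 1:] n) = (\<Prod>z\<in>{z. z ^ n = 1} - {1}. [:- z, 1:])"
      using assms(3) by (simp add: cpoly_qint)
  qed (use ord z3 in blast)
  moreover have "qint [:0, 1:] n * cyclotomic n ^ 2 dvd qint [:0, 1:] n * qint [:0, 1:] n ^ 2"
    using assms(3) by (intro mult_dvd_mono dvd_power_same cyclotomic_dvd_qint) auto
  then have "qint [:0, 1:] n * cyclotomic n ^ 2 dvd qint [:0, 1:] n ^ 3"
    unfolding power_Suc[symmetric] by simp
  ultimately have "qint [:0, 1:] n * cyclotomic n ^ 2 dvd ?U" by (rule dvd_trans[rotated])
  then show "ratfun_cong S 0 (qint [:0, 1:] n * cyclotomic n ^ 2)" by (simp add: ratfun_cong_def)
qed

end
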